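(* Let $f:\mathbb{R}^d\to\mathbb{R}$ be coordinate-wise glocally $(L,L_*,\delta)$-smooth and $\mu_1$-strongly convex in the $1$-norm with $\mu_1>0$, and let $f_*$ be its infimum. Let $w_0\in\mathbb{R}^d$, $\Delta_0=f(w_0)-f_*$, and let $\epsilon$ satisfy $\Delta_0>\delta>\epsilon>0$. For all $t\ge0$ let $$w_{t+1}=w_t-\eta_t\nabla_{j_t}f(w_t)e_{j_t},\qquad j_t\in\arg\max_j|\nabla_jf(w_t)|,\qquad \eta_t\in\arg\min_\eta f(w_t-\eta\nabla_{j_t}f(w_t)e_{j_t}).$$ Then $f(w_T)-f_*\le\epsilon$ for all integers $T$ with $$T\ge\frac{L}{\mu_1}\log\left(\frac{\Delta_0}{\delta}\right)+\frac{L_*}{\mu_1}\log\left(\frac{\delta}{\epsilon}\right)+1.$$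
   Context: Functions are differentiable and $L,L_*,\delta>0$. $\nabla_jf(w)$ is the $j$th coordinate of $\nabla f(w)$ and $e_j$ is the $j$th standard basis vector. Coordinate-wise glocal smoothness: $f$ is coordinate-wise glocally $(L,L_*,\delta)$-smooth if (i) $|\nabla_jf(u+\alpha e_j)-\nabla_jf(u)|\le L|\alpha|$ for all $u\in\mathbb{R}^d$, $j\in\{1,\dots,d\}$, $\alpha\in\mathbb{R}$, and (ii) $|\nabla_jf(u+\alpha e_j)-\nabla_jf(u)|\le L_*|\alpha|$ whenever $u$ and $u+\alpha e_j$ both lie in $\{u:f(u)-f_*\le\delta\}$. Strong convexity in the $1$-norm: $f(v)\ge f(u)+\langle\nabla f(u),v-u\rangle+\frac{\mu_1}{2}\|v-u\|_1^2$ for all $u,v\in\mathbb{R}^d$. *)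

theory Defs
  imports "HOL-Analysis.Analysis"
begin

definition grad :: "('a::real_inner \<Rightarrow> real) \<Rightarrow> 'a \<Rightarrow> 'a" where
  "grad f x = (THE D. GDERIV f x :> D)"

lemma GDERIV_grad:
  fixes f :: "'a::euclidean_space \<Rightarrow> real"
  assumes "f differentiable (at x)"
  shows "GDERIV f x :> grad f x"
proof -
  obtain f' where f': "(f has_derivative f') (at x)"
    using assms by (auto simp: differentiable_def)
  define D where "D = adjoint f' 1"
  have "f' = (\<lambda>h. h \<bullet> D)"
    using adjoint_works[OF has_derivative_linear[OF f'], of _ 1] by (auto simp: D_def)
  with f' have D: "GDERIV f x :> D"
    by (simp add: gderiv_def)
  have "E = D" if "GDERIV f x :> E" for E
    using has_derivative_unique[OF that[unfolded gderiv_def] D[unfolded gderiv_def]]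
    by (metis vector_eq_rdot inner_commute)
  with D show ?thesis
    unfolding grad_def by (rule theI)
qed

(* The real-valued infimum is only meaningful if f is bounded below; for strongly convex f
   this is lemma strongly_convex_l1_bdd_below. *)
definition inf_value :: "('a \<Rightarrow> real) \<Rightarrow> real" where
  "inf_value f = (INF u. f u)"

definition coord_glocal_smooth ::
    "(real ^ 'n \<Rightarrow> real) \<Rightarrow> real \<Rightarrow> real \<Rightarrow> real \<Rightarrow> bool" where
  "coord_glocal_smooth f L Lstar \<delta> \<longleftrightarrow>
     (\<forall>u j \<alpha>. \<bar>grad f (u + \<alpha> *\<^sub>R axis j 1) $ j - grad f u $ j\<bar> \<le> L * \<bar>\<alpha>\<bar>) \<and>
     (\<forall>u j \<alpha>. u \<in> {x. f x - inf_value f \<le> \<delta>} \<longrightarrow>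
        u + \<alpha> *\<^sub>R axis j 1 \<in> {x. f x - inf_value f \<le> \<delta>} \<longrightarrow>
        \<bar>grad f (u + \<alpha> *\<^sub>R axis j 1) $ j - grad f u $ j\<bar> \<le> Lstar * \<bar>\<alpha>\<bar>)"

definition l1_norm :: "real ^ 'n \<Rightarrow> real" where
  "l1_norm v = (\<Sum>j\<in>UNIV. \<bar>v $ j\<bar>)"

definition strongly_convex_l1 :: "(real ^ 'n \<Rightarrow> real) \<Rightarrow> real \<Rightarrow> bool" where
  "strongly_convex_l1 f \<mu> \<longleftrightarrow>
     (\<forall>u v. f v \<ge> f u + grad f u \<bullet> (v - u) + \<mu> / 2 * (l1_norm (v - u))\<^sup>2)"

lemma strongly_convex_l1_bdd_below:
  fixes f :: "real ^ 'n \<Rightarrow> real"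
  assumes "strongly_convex_l1 f \<mu>" and "\<mu> > 0"
  shows "bdd_below (range f)"
proof (rule bdd_belowI2)
  fix v :: "real ^ 'n"
  define a where "a = norm (grad f 0)"
  define b where "b = norm v"
  have "b \<le> l1_norm v"
    unfolding b_def l1_norm_def by (rule norm_le_l1_cart)
  then have "\<mu> / 2 * b\<^sup>2 \<le> \<mu> / 2 * (l1_norm v)\<^sup>2"
    using \<open>\<mu> > 0\<close> by (intro mult_left_mono power_mono) (auto simp: b_def)
  moreover have "- (a * b) \<le> grad f 0 \<bullet> v"
    using Cauchy_Schwarz_ineq2[of "grad f 0" v] by (auto simp: a_def b_def)
  moreover have "f v \<ge> f 0 + grad f 0 \<bullet> v + \<mu> / 2 * (l1_norm v)\<^sup>2"
    using assms(1) unfolding strongly_convex_l1_def by (metis diff_zero)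
  moreover have "- (a\<^sup>2 / (2 * \<mu>)) \<le> \<mu> / 2 * b\<^sup>2 - a * b"
  proof -
    have "\<mu> / 2 * b\<^sup>2 - a * b + a\<^sup>2 / (2 * \<mu>) = (\<mu> * b - a)\<^sup>2 / (2 * \<mu>)"
      using \<open>\<mu> > 0\<close> by (simp add: field_simps power2_eq_square)
    also have "\<dots> \<ge> 0"
      using \<open>\<mu> > 0\<close> by simp
    finally show ?thesis by simp
  qed
  ultimately show "f 0 - a\<^sup>2 / (2 * \<mu>) \<le> f v" by linarith
qed

end

theory Submission
  imports Defs
begin

text \<open>
  Write \<open>\<Delta>\<close> for the gap \<open>f - f\<^sub>*\<close>. Restricted to a coordinate line through the
  iterate, \<open>f\<close> is convex, and exact line search moves to its minimiser on that line. The
  derivative changes from \<open>g\<close> to \<open>0\<close> on the way there, so if \<open>K\<close> is a Lipschitz constant for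
  it, the minimiser is at distance at least \<open>\<bar>g\<bar> / K\<close>. Hence the classical step of length
  \<open>\<bar>g\<bar> / K\<close> does not pass the minimiser, and by convexity it never leaves the sublevel set of the
  current iterate. So the usual decrease by \<open>g\<^sup>2 / (2 K)\<close> follows from Lipschitz continuity on
  that sublevel set alone (\<open>exact_line_search_decrease\<close>): \<open>K = L\<close> is always admissible, and
  \<open>K = Lstar\<close> is admissible once \<open>\<Delta> \<le> \<delta>\<close>.

  Strong convexity in the 1-norm is dual to the maximum norm of the gradient: it gives
  \<open>2 \<mu> \<Delta> \<le> g\<^sup>2\<close> when \<open>g\<close> is the largest partial derivative
  (\<open>gap_le_max_partial_derivative\<close>), which is what the greedy choice of the coordinate provides.
  Together, each step multiplies \<open>\<Delta>\<close> by at most \<open>1 - \<mu> / K \<le> exp (- \<mu> / K)\<close>.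

  With \<open>A\<close> and \<open>B\<close> the two logarithmic terms of the bound, \<open>\<lceil>A\<rceil>\<close> steps at rate \<open>\<mu> / L\<close> reach
  \<open>\<Delta> \<le> \<delta>\<close>, and \<open>\<lceil>B\<rceil>\<close> further steps at rate \<open>\<mu> / Lstar\<close> reach \<open>\<Delta> \<le> \<epsilon>\<close>. Rounding up twice
  costs less than \<open>2\<close>, so \<open>T \<ge> A + B + 1\<close> gives \<open>T > \<lceil>A\<rceil> + \<lceil>B\<rceil> - 1\<close>, which for an integer \<open>T\<close>
  means \<open>T \<ge> \<lceil>A\<rceil> + \<lceil>B\<rceil>\<close>.
\<close>

section \<open>Decrease by an exact line search\<close>

text \<open>
  The first-order inequality \<open>tangent\<close> expresses convexity. The Lipschitz bound is
  only required from the starting point to points of its sublevel set, which is the form in which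
  both halves of glocal smoothness apply. The comparison point is \<open>- \<phi>' 0 / K\<close>, which lies
  between \<open>0\<close> and the minimiser \<open>m\<close>.
\<close>

lemma exact_line_search_decrease:
  fixes \<phi> \<phi>' :: "real \<Rightarrow> real"
  assumes deriv: "\<And>s. (\<phi> has_real_derivative \<phi>' s) (at s)"
    and tangent: "\<And>s t. \<phi> t \<ge> \<phi> s + \<phi>' s * (t - s)"
    and min: "\<And>s. \<phi> m \<le> \<phi> s"
    and "K > 0"
    and lip: "\<And>s. \<phi> s \<le> \<phi> 0 \<Longrightarrow> \<bar>\<phi>' s - \<phi>' 0\<bar> \<le> K * \<bar>s\<bar>"
  shows "\<phi> m \<le> \<phi> 0 - (\<phi>' 0)\<^sup>2 / (2 * K)"
proof (cases "\<phi>' 0 = 0")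
  case True
  then show ?thesis using min[of 0] by simp
next
  case False
  define r where "r = - \<phi>' 0 / K"
  have "\<phi>' m = 0"
    using DERIV_local_min[OF deriv, of 1] min by auto
  then have far: "\<bar>\<phi>' 0\<bar> \<le> K * \<bar>m\<bar>"
    using lip[OF min] by simp
  then have "m \<noteq> 0" using False by auto
  have "\<phi>' 0 * m \<le> 0"
    using tangent[of 0 m] min[of 0] by simp
  then have "r * m \<ge> 0"
    using \<open>K > 0\<close> by (simp add: r_def divide_le_0_iff)
  moreover have "\<bar>r\<bar> \<le> \<bar>m\<bar>"
    using far \<open>K > 0\<close> by (simp add: r_def abs_divide field_simps)
  ultimately have \<theta>: "0 \<le> r / m" "r / m \<le> 1"
    using \<open>m \<noteq> 0\<close> by (auto simp: zero_le_divide_iff zero_le_mult_iff divide_le_eq)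
  have sublevel: "\<phi> (\<tau> * r) \<le> \<phi> 0" if "0 \<le> \<tau>" "\<tau> \<le> 1" for \<tau>
  proof -
    define c where "c = \<tau> * (r / m)"
    have c: "0 \<le> c" "c \<le> 1"
      unfolding c_def using that \<theta> mult_nonneg_nonneg[of \<tau> "r / m"] mult_le_one[of \<tau> "r / m"] by blast+
    have cm: "\<tau> * r = c * m" using \<open>m \<noteq> 0\<close> by (simp add: c_def)
    have "(1 - c) * \<phi> 0 + c * \<phi> m \<ge>
        (1 - c) * (\<phi> (c * m) + \<phi>' (c * m) * (0 - c * m)) +
        c * (\<phi> (c * m) + \<phi>' (c * m) * (m - c * m))"
      using c by (intro add_mono mult_left_mono tangent) auto
    also have "(1 - c) * (\<phi> (c * m) + \<phi>' (c * m) * (0 - c * m)) +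
        c * (\<phi> (c * m) + \<phi>' (c * m) * (m - c * m)) = \<phi> (c * m)"
      by (simp add: algebra_simps)
    finally have "\<phi> (c * m) \<le> (1 - c) * \<phi> 0 + c * \<phi> m" .
    also have "\<dots> \<le> \<phi> 0"
      using mult_left_mono[OF min[of 0] c(1)] by (simp add: algebra_simps)
    finally show ?thesis by (simp add: cm)
  qed
  \<comment> \<open>The error of the quadratic upper model, along the segment from the start to \<open>r\<close>.\<close>
  define h where "h = (\<lambda>\<tau>. \<phi> (\<tau> * r) - \<tau> * (r * \<phi>' 0) - K / 2 * (\<tau> * r)\<^sup>2)"
  have "h 1 \<le> h 0"
  proof (rule DERIV_nonpos_imp_nonincreasing[where f = h])
    fix \<tau> :: real assume \<tau>: "0 \<le> \<tau>" "\<tau> \<le> 1"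
    have "((\<lambda>\<tau>. \<phi> (\<tau> * r)) has_real_derivative \<phi>' (\<tau> * r) * r) (at \<tau>)"
      by (rule DERIV_chain2[OF deriv]) (auto intro!: derivative_eq_intros)
    then have h: "(h has_real_derivative
        \<phi>' (\<tau> * r) * r - r * \<phi>' 0 - K / 2 * (2 * (\<tau> * r) * r)) (at \<tau>)"
      unfolding h_def by (auto intro!: derivative_eq_intros)
    have "r * (\<phi>' (\<tau> * r) - \<phi>' 0) \<le> \<bar>r\<bar> * (K * \<bar>\<tau> * r\<bar>)"
      using mult_left_mono[OF lip[OF sublevel[OF \<tau>]], of "\<bar>r\<bar>"]
      by (metis abs_ge_self abs_ge_zero abs_mult order_trans)
    moreover have "\<bar>r\<bar> * (K * \<bar>\<tau> * r\<bar>) = K / 2 * (2 * (\<tau> * r) * r)"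
      using \<tau> by (simp add: abs_mult)
    ultimately have "\<phi>' (\<tau> * r) * r - r * \<phi>' 0 - K / 2 * (2 * (\<tau> * r) * r) \<le> 0"
      by (simp only: right_diff_distrib mult.commute[of r "\<phi>' (\<tau> * r)"])
    with h show "\<exists>y. (h has_real_derivative y) (at \<tau>) \<and> y \<le> 0"
      by blast
  qed simp
  then have "\<phi> r \<le> \<phi> 0 + r * \<phi>' 0 + K / 2 * r\<^sup>2"
    by (simp add: h_def)
  also have "\<dots> = \<phi> 0 - (\<phi>' 0)\<^sup>2 / (2 * K)"
    using \<open>K > 0\<close> by (simp add: r_def field_simps power2_eq_square)
  finally show ?thesis using min[of r] by linarith
qed

lemma has_real_derivative_coordinate_line:
  fixes f :: "real ^ 'n \<Rightarrow> real"
  assumes "\<And>x. f differentiable (at x)"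
  shows "((\<lambda>s. f (u + s *\<^sub>R axis i 1)) has_real_derivative
    grad f (u + s *\<^sub>R axis i 1) $ i) (at s)"
proof -
  have "(f has_derivative (\<lambda>h. h \<bullet> grad f (u + s *\<^sub>R axis i 1))) (at (u + s *\<^sub>R axis i 1))"
    using GDERIV_grad[OF assms] by (simp add: gderiv_def)
  moreover have "((\<lambda>s. u + s *\<^sub>R axis i 1) has_derivative (\<lambda>h. h *\<^sub>R axis i (1::real))) (at s)"
    by (auto intro!: derivative_eq_intros)
  ultimately have "((\<lambda>s. f (u + s *\<^sub>R axis i 1)) has_derivative
      (\<lambda>h. (h *\<^sub>R axis i 1) \<bullet> grad f (u + s *\<^sub>R axis i 1))) (at s)"
    by (rule has_derivative_compose[rotated])
  then show ?thesis
    by (simp add: has_field_derivative_def inner_axis' mult_commute_abs)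
qed

lemma coordinate_line_search_decrease:
  fixes f :: "real ^ 'n \<Rightarrow> real"
  assumes diff: "\<And>x. f differentiable (at x)"
    and sc: "strongly_convex_l1 f \<mu>" and "\<mu> \<ge> 0" and "K > 0"
    and lip: "\<And>s. f (u + s *\<^sub>R axis i 1) \<le> f u \<Longrightarrow>
      \<bar>grad f (u + s *\<^sub>R axis i 1) $ i - grad f u $ i\<bar> \<le> K * \<bar>s\<bar>"
    and min: "\<And>s. f (u + m *\<^sub>R axis i 1) \<le> f (u + s *\<^sub>R axis i 1)"
  shows "f (u + m *\<^sub>R axis i 1) \<le> f u - (grad f u $ i)\<^sup>2 / (2 * K)"
proof -
  define \<phi> where "\<phi> = (\<lambda>s. f (u + s *\<^sub>R axis i 1))"
  define \<phi>' where "\<phi>' = (\<lambda>s. grad f (u + s *\<^sub>R axis i 1) $ i)"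
  have "\<phi> m \<le> \<phi> 0 - (\<phi>' 0)\<^sup>2 / (2 * K)"
  proof (rule exact_line_search_decrease)
    show "(\<phi> has_real_derivative \<phi>' s) (at s)" for s
      unfolding \<phi>_def \<phi>'_def by (rule has_real_derivative_coordinate_line[OF diff])
    show "\<phi> t \<ge> \<phi> s + \<phi>' s * (t - s)" for s t
    proof -
      define a b where "a = u + s *\<^sub>R axis i 1" and "b = u + t *\<^sub>R axis i 1"
      have "f b \<ge> f a + grad f a \<bullet> (b - a) + \<mu> / 2 * (l1_norm (b - a))\<^sup>2"
        using sc by (simp add: strongly_convex_l1_def)
      moreover have "\<mu> / 2 * (l1_norm (b - a))\<^sup>2 \<ge> 0" using \<open>\<mu> \<ge> 0\<close> by simp
      moreover have "b - a = (t - s) *\<^sub>R axis i 1"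
        by (simp add: a_def b_def algebra_simps)
      then have "grad f a \<bullet> (b - a) = grad f a $ i * (t - s)"
        by (simp add: inner_axis)
      ultimately show ?thesis by (simp add: \<phi>_def \<phi>'_def a_def b_def)
    qed
  qed (use lip min \<open>K > 0\<close> in \<open>auto simp: \<phi>_def \<phi>'_def\<close>)
  then show ?thesis by (simp add: \<phi>_def \<phi>'_def)
qed

section \<open>Greedy coordinate steps under strong convexity in the 1-norm\<close>

text \<open>
  This is where the 1-norm matters: \<open>\<langle>\<nabla>f u, v - u\<rangle> \<ge> - G * l1_norm (v - u)\<close> for a bound \<open>G\<close> on
  all partial derivatives, and minimising the lower bound for \<open>f v\<close> over the value of the norm
  leaves \<open>f u - G\<^sup>2 / (2 * \<mu>)\<close>.
\<close>

lemma gap_le_max_partial_derivative: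
  fixes f :: "real ^ 'n \<Rightarrow> real"
  assumes sc: "strongly_convex_l1 f \<mu>" and "\<mu> > 0"
    and G: "\<And>i. \<bar>grad f u $ i\<bar> \<le> G"
  shows "f u - inf_value f \<le> G\<^sup>2 / (2 * \<mu>)"
proof -
  have "f u - G\<^sup>2 / (2 * \<mu>) \<le> f v" for v
  proof -
    define n where "n = l1_norm (v - u)"
    have "\<bar>grad f u \<bullet> (v - u)\<bar> \<le> (\<Sum>i\<in>UNIV. \<bar>grad f u $ i * (v - u) $ i\<bar>)"
      unfolding inner_vec_def inner_real_def by (rule sum_abs)
    also have "\<dots> \<le> (\<Sum>i\<in>UNIV. G * \<bar>(v - u) $ i\<bar>)"
      unfolding abs_mult by (intro sum_mono mult_right_mono G) auto
    also have "\<dots> = G * n" by (simp add: n_def l1_norm_def sum_distrib_left)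
    finally have "grad f u \<bullet> (v - u) \<ge> - (G * n)" by linarith
    moreover have "f v \<ge> f u + grad f u \<bullet> (v - u) + \<mu> / 2 * n\<^sup>2"
      using sc by (simp add: strongly_convex_l1_def n_def)
    moreover have "\<mu> / 2 * n\<^sup>2 - G * n + G\<^sup>2 / (2 * \<mu>) = (\<mu> * n - G)\<^sup>2 / (2 * \<mu>)"
      using \<open>\<mu> > 0\<close> by (simp add: field_simps power2_eq_square)
    moreover have "(\<mu> * n - G)\<^sup>2 / (2 * \<mu>) \<ge> 0" using \<open>\<mu> > 0\<close> by simp
    ultimately show ?thesis by linarith
  qed
  then have "f u - G\<^sup>2 / (2 * \<mu>) \<le> inf_value f"
    unfolding inf_value_def by (intro cINF_greatest) auto
  then show ?thesis by linarith
qed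

text \<open>
  The greedy rule makes the partial derivative that drives the decrease the same one that bounds
  the gap, so that no factor for the dimension appears. The factor \<open>1 - \<mu> / K\<close> is relaxed to an
  exponential, which matches the logarithms in the iteration count.
\<close>

lemma greedy_step_contraction:
  fixes f :: "real ^ 'n \<Rightarrow> real"
  assumes diff: "\<And>x. f differentiable (at x)"
    and sc: "strongly_convex_l1 f \<mu>" and "\<mu> > 0" and "K > 0"
    and lip: "\<And>s. f (u + s *\<^sub>R axis i 1) \<le> f u \<Longrightarrow>
      \<bar>grad f (u + s *\<^sub>R axis i 1) $ i - grad f u $ i\<bar> \<le> K * \<bar>s\<bar>"
    and greedy: "is_arg_max (\<lambda>i. \<bar>grad f u $ i\<bar>) (\<lambda>i. True) i"
    and search: "is_arg_min (\<lambda>s. f (u - (s * grad f u $ i) *\<^sub>R axis i 1)) (\<lambda>s. True) \<eta>"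
  shows "f (u - (\<eta> * grad f u $ i) *\<^sub>R axis i 1) - inf_value f \<le>
    exp (- (\<mu> / K)) * (f u - inf_value f)"
proof -
  define g where "g = grad f u $ i"
  define \<Delta> where "\<Delta> = f u - inf_value f"
  have "\<bar>grad f u $ k\<bar> \<le> \<bar>g\<bar>" for k
    using greedy by (simp add: is_arg_max_linorder g_def)
  from gap_le_max_partial_derivative[OF sc \<open>\<mu> > 0\<close> this]
  have gap: "\<Delta> \<le> g\<^sup>2 / (2 * \<mu>)" by (simp add: \<Delta>_def)
  have "inf_value f \<le> f u"
    unfolding inf_value_def
    by (rule cINF_lower[OF strongly_convex_l1_bdd_below[OF sc \<open>\<mu> > 0\<close>]]) simp
  then have "\<Delta> \<ge> 0" by (simp add: \<Delta>_def)
  have "f (u - (\<eta> * g) *\<^sub>R axis i 1) \<le> f u - g\<^sup>2 / (2 * K)"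
  proof (cases "g = 0")
    case False
    \<comment> \<open>For \<open>g \<noteq> 0\<close> the points \<open>u - (s * g) e\<^sub>i\<close> exhaust the coordinate line.\<close>
    have "f (u + (- (\<eta> * g)) *\<^sub>R axis i 1) \<le> f (u + s *\<^sub>R axis i 1)" for s
    proof -
      have "f (u - (\<eta> * g) *\<^sub>R axis i 1) \<le> f (u - ((- s / g) * g) *\<^sub>R axis i 1)"
        using search unfolding is_arg_min_linorder g_def by blast
      then show ?thesis using False by simp
    qed
    from coordinate_line_search_decrease[OF diff sc less_imp_le[OF \<open>\<mu> > 0\<close>] \<open>K > 0\<close> lip this]
    show ?thesis by (simp add: g_def)
  qed simp
  then have "f (u - (\<eta> * g) *\<^sub>R axis i 1) - inf_value f \<le> \<Delta> - g\<^sup>2 / (2 * K)"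
    by (simp add: \<Delta>_def)
  also have "\<dots> \<le> \<Delta> - \<mu> / K * \<Delta>"
    using mult_left_mono[OF gap, of "\<mu> / K"] \<open>\<mu> > 0\<close> \<open>K > 0\<close> by (simp add: field_simps)
  also have "\<dots> = (1 + - (\<mu> / K)) * \<Delta>" by (simp add: algebra_simps)
  also have "\<dots> \<le> exp (- (\<mu> / K)) * \<Delta>"
    using \<open>\<Delta> \<ge> 0\<close> by (intro mult_right_mono exp_ge_add_one_self)
  finally show ?thesis by (simp add: g_def \<Delta>_def)
qed

section \<open>Iteration counts for the two phases\<close>

lemma exponential_decay_reaches:
  fixes x :: "nat \<Rightarrow> real"
  assumes step: "\<And>t. x (Suc t) \<le> exp (- c) * x t"
    and "c > 0" and "b > 0" and "a > 0" and "x 0 \<le> a"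
    and n: "real n \<ge> 1 / c * ln (a / b)"
  shows "x n \<le> b"
proof -
  have "x k \<le> exp (- (real k * c)) * a" for k
  proof (induction k)
    case (Suc k)
    have "x (Suc k) \<le> exp (- c) * (exp (- (real k * c)) * a)"
      by (intro order_trans[OF step] mult_left_mono Suc) simp
    then show ?case by (simp add: algebra_simps exp_add[symmetric] flip: mult.assoc)
  qed (use \<open>x 0 \<le> a\<close> in simp)
  moreover have "ln (a / b) \<le> real n * c"
    using n \<open>c > 0\<close> by (simp add: field_simps)
  then have "exp (- (real n * c)) * a \<le> exp (- ln (a / b)) * a"
    using \<open>a > 0\<close> by simp
  moreover have "exp (- ln (a / b)) * a = b"
    using \<open>a > 0\<close> \<open>b > 0\<close> by (simp add: exp_minus)
  ultimately show ?thesis by (metis order_trans)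
qed

theorem theorem7:
  fixes f :: "real ^ 'n \<Rightarrow> real"
    and L Lstar \<delta> \<mu>1 \<epsilon> :: real
    and w :: "nat \<Rightarrow> real ^ 'n"
    and j :: "nat \<Rightarrow> 'n"
    and \<eta> :: "nat \<Rightarrow> real"
  assumes "\<And>x. f differentiable (at x)"
    and "L > 0" and "Lstar > 0" and "\<delta> > 0" and "\<mu>1 > 0"
    and "coord_glocal_smooth f L Lstar \<delta>"
    and "strongly_convex_l1 f \<mu>1"
    and "f (w 0) - inf_value f > \<delta>" and "\<delta> > \<epsilon>" and "\<epsilon> > 0"
    and "\<And>t. w (Suc t) = w t - (\<eta> t * grad f (w t) $ j t) *\<^sub>R axis (j t) 1"
    and "\<And>t. is_arg_max (\<lambda>i. \<bar>grad f (w t) $ i\<bar>) (\<lambda>i. True) (j t)"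
    and "\<And>t. is_arg_min (\<lambda>s. f (w t - (s * grad f (w t) $ j t) *\<^sub>R axis (j t) 1))
                 (\<lambda>s. True) (\<eta> t)"
  shows "\<forall>T::nat. real T \<ge> L / \<mu>1 * ln ((f (w 0) - inf_value f) / \<delta>)
                         + Lstar / \<mu>1 * ln (\<delta> / \<epsilon>) + 1
           \<longrightarrow> f (w T) - inf_value f \<le> \<epsilon>"
proof (intro allI impI)
  fix T :: nat
  define A where "A = L / \<mu>1 * ln ((f (w 0) - inf_value f) / \<delta>)"
  define B where "B = Lstar / \<mu>1 * ln (\<delta> / \<epsilon>)"
  assume "real T \<ge> L / \<mu>1 * ln ((f (w 0) - inf_value f) / \<delta>)
    + Lstar / \<mu>1 * ln (\<delta> / \<epsilon>) + 1"
  then have T: "real T \<ge> A + B + 1" by (simp add: A_def B_def)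
  define x where "x = (\<lambda>t. f (w t) - inf_value f)"
  have contraction: "x (Suc t) \<le> exp (- (\<mu>1 / K)) * x t"
    if "K > 0" and "\<And>s. f (w t + s *\<^sub>R axis (j t) 1) \<le> f (w t) \<Longrightarrow>
      \<bar>grad f (w t + s *\<^sub>R axis (j t) 1) $ j t - grad f (w t) $ j t\<bar> \<le> K * \<bar>s\<bar>" for t K
    unfolding x_def assms(11)
    by (rule greedy_step_contraction) (use assms that in auto)
  have global: "x (Suc t) \<le> exp (- (\<mu>1 / L)) * x t" for t
    by (rule contraction) (use assms in \<open>auto simp: coord_glocal_smooth_def\<close>)
  have local: "x (Suc t) \<le> exp (- (\<mu>1 / Lstar)) * x t" if "x t \<le> \<delta>" for t
  proof (rule contraction[OF \<open>Lstar > 0\<close>])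
    fix s assume "f (w t + s *\<^sub>R axis (j t) 1) \<le> f (w t)"
    with that have "w t \<in> {x. f x - inf_value f \<le> \<delta>}"
      and "w t + s *\<^sub>R axis (j t) 1 \<in> {x. f x - inf_value f \<le> \<delta>}"
      by (auto simp: x_def)
    then show "\<bar>grad f (w t + s *\<^sub>R axis (j t) 1) $ j t - grad f (w t) $ j t\<bar> \<le> Lstar * \<bar>s\<bar>"
      using assms(6) unfolding coord_glocal_smooth_def by blast
  qed
  have nonneg: "x t \<ge> 0" for t
    using cINF_lower[OF strongly_convex_l1_bdd_below[OF assms(7,5)], of "w t"]
    by (simp add: x_def inf_value_def)
  have antimono: "x (Suc t) \<le> x t" for t
  proof -
    have "exp (- (\<mu>1 / L)) * x t \<le> 1 * x t"
      using nonneg[of t] assms by (intro mult_right_mono) auto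
    then show ?thesis using global[of t] by linarith
  qed
  have mono: "x n \<le> x m" if "m \<le> n" for m n
    using lift_Suc_antimono_le[of x, OF antimono that] .
  have "A > 0" "B > 0"
    unfolding A_def B_def using assms by (auto intro!: mult_pos_pos)
  define a b where "a = nat \<lceil>A\<rceil>" and "b = nat \<lceil>B\<rceil>"
  have ab: "real a \<ge> A" "real b \<ge> B" "real a < A + 1" "real b < B + 1"
    using \<open>A > 0\<close> \<open>B > 0\<close> unfolding a_def b_def by linarith+
  have reached_\<delta>: "x a \<le> \<delta>"
    by (rule exponential_decay_reaches[where c = "\<mu>1 / L" and a = "x 0"])
      (use global assms ab in \<open>auto simp: A_def x_def\<close>)
  have "x (a + b) \<le> \<epsilon>"
  proof (rule exponential_decay_reaches[where x = "\<lambda>t. x (a + t)" and c = "\<mu>1 / Lstar" and a = \<delta>])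
    show "x (a + Suc t) \<le> exp (- (\<mu>1 / Lstar)) * x (a + t)" for t
      using local[of "a + t"] mono[of a "a + t"] reached_\<delta> by simp
  qed (use assms ab reached_\<delta> in \<open>auto simp: B_def\<close>)
  moreover have "a + b \<le> T"
  proof -
    have "real (a + b) < real (T + 1)" using T ab by simp
    then show ?thesis by linarith
  qed
  ultimately show "f (w T) - inf_value f \<le> \<epsilon>"
    using mono[of "a + b" T] by (simp add: x_def)
qed

end
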